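(* Let $m\ge 2$ be an integer and let $n_1,\ldots,n_m\in\mathbb{N}_{\ge1}$ be fixed. Let $\Delta_{m-1}=\{p\in[0,1]^m: p_1+\cdots+p_m=1\}$ denote the $(m-1)$-dimensional simplex in $\mathbb{R}^m$. Then the function $$\pi\colon\Delta_{m-1}\to\Delta_{m-1},\qquad p=(p_1,\ldots,p_m)\mapsto(\pi_1(p),\ldots,\pi_m(p)),$$ where $\pi_\ell(p)$ is the winning probability of player $\ell$ when the advancing probabilities are $p$, is a bijection. The restriction of $\pi$ to the relative interior of $\Delta_{m-1}$ is a diffeomorphism (onto the relative interior of $\Delta_{m-1}$).
   Context: Game: for $p\in\Delta_{m-1}$ let $R=(R_n)_{n\ge 0}$, $R_n=(R_{n,1},\ldots,R_{n,m})$, be the random walk on $\mathbb{N}^m$ (with $0\in\mathbb{N}$) starting at $R_0=0$ which in each step, independently of the past, moves from $\xi$ to $\xi+e_\ell$ with probability $p_\ell$, $\ell=1,\ldots,m$ ($e_\ell$ the $\ell$-th canonical basis vector). The winning probability of player $\ell$ is $$\pi_\ell(p):=\mathbb{P}\Big(\bigcup_{n=1}^\infty\{R_{n,\ell}=n_\ell,\ R_{n-1,\ell}=n_\ell-1,\ R_{n,k}<n_k \text{ for all } 1\le k\le m,\ k\ne\ell\}\Big),$$ i.e. the probability that coordinate $\ell$ reaches $n_\ell$ before any other coordinate $k$ reaches $n_k$. *)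

theory Defs
  imports "HOL-Probability.Probability"
begin

definition prob_simplex :: "(real ^ 'm::finite) set" where
  "prob_simplex = {p. (\<forall>l. 0 \<le> p $ l \<and> p $ l \<le> 1) \<and> (\<Sum>l\<in>UNIV. p $ l) = 1}"

(* step_pmf p and everything built on it are meaningful only for p in prob_simplex:
   embed_pmf is unspecified on functions that are not probability mass functions. *)
definition step_pmf :: "real ^ 'm::finite \<Rightarrow> 'm pmf" where
  "step_pmf p = embed_pmf (\<lambda>l. p $ l)"

definition steps :: "real ^ 'm::finite \<Rightarrow> (nat \<Rightarrow> 'm) measure" where
  "steps p = Pi\<^sub>M UNIV (\<lambda>_. measure_pmf (step_pmf p))"

(* Canonical realisation of the walk: the sample point w is the sequence of chosen coordinates,
   so the increments axis (w n) 1 are independent and equal the l-th canonical basis vector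
   with probability p $ l. *)
primrec walk :: "(nat \<Rightarrow> 'm::finite) \<Rightarrow> nat \<Rightarrow> nat ^ 'm" where
  "walk w 0 = 0"
| "walk w (Suc n) = walk w n + axis (w n) 1"

definition wins :: "nat ^ 'm::finite \<Rightarrow> 'm \<Rightarrow> (nat \<Rightarrow> 'm) set" where
  "wins N l = (\<Union>n\<in>{1..}. {w. walk w n $ l = N $ l \<and> walk w (n - 1) $ l = N $ l - 1 \<and>
     (\<forall>k. k \<noteq> l \<longrightarrow> walk w n $ k < N $ k)})"

definition win_prob :: "nat ^ 'm::finite \<Rightarrow> real ^ 'm \<Rightarrow> real ^ 'm" where
  "win_prob N p = (\<chi> l. measure (steps p) (wins N l))"

(* Continuous differentiability of order k, via iterated directional derivatives;
   intended for open S. *)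
primrec Ck_on :: "nat \<Rightarrow> 'a set \<Rightarrow> ('a::euclidean_space \<Rightarrow> 'b::euclidean_space) \<Rightarrow> bool" where
  "Ck_on 0 S f \<longleftrightarrow> continuous_on S f"
| "Ck_on (Suc k) S f \<longleftrightarrow> (\<forall>x\<in>S. f differentiable (at x)) \<and>
     (\<forall>v. Ck_on k S (\<lambda>x. frechet_derivative f (at x) v))"

(* Smoothness on an arbitrary subset of a Euclidean space (e.g. an embedded submanifold):
   locally the restriction of a map that is C-infinity on an open set of the ambient space. *)
definition smooth_on :: "'a set \<Rightarrow> ('a::euclidean_space \<Rightarrow> 'b::euclidean_space) \<Rightarrow> bool" where
  "smooth_on S f \<longleftrightarrow> (\<forall>x\<in>S. \<exists>U g. open U \<and> x \<in> U \<and> (\<forall>k. Ck_on k U g) \<and>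
     (\<forall>y\<in>S \<inter> U. g y = f y))"

definition diffeomorphism ::
  "'a set \<Rightarrow> 'b set \<Rightarrow> ('a::euclidean_space \<Rightarrow> 'b::euclidean_space) \<Rightarrow> bool" where
  "diffeomorphism S T f \<longleftrightarrow> bij_betw f S T \<and> smooth_on S f \<and> smooth_on T (inv_into S f)"

lemma pmf_step_pmf:
  assumes "p \<in> prob_simplex"
  shows "pmf (step_pmf p) l = p $ l"
  unfolding step_pmf_def
proof (rule pmf_embed_pmf)
  show "0 \<le> p $ i" for i
    using assms by (simp add: prob_simplex_def)
  then show "(\<integral>\<^sup>+i. ennreal (p $ i) \<partial>count_space UNIV) = 1"
    using assms by (simp add: prob_simplex_def nn_integral_count_space_finite)
qed

lemma sets_wins: "wins N l \<in> sets (steps p)"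
proof -
  have sp: "space (steps p) = UNIV"
    by (simp add: steps_def space_PiM)
  have comp [measurable]: "(\<lambda>w. w i) \<in> measurable (steps p) (count_space UNIV)" for i
    using measurable_component_singleton[of i UNIV "\<lambda>_. measure_pmf (step_pmf p)"]
    by (simp add: steps_def)
  have [measurable]: "(\<lambda>w. walk w n $ k) \<in> measurable (steps p) (count_space UNIV)" for n k
  proof (induction n)
    case (Suc n)
    note Suc [measurable]
    have "(\<lambda>w. walk w n $ k + (if w n = k then 1 else 0)) \<in> measurable (steps p) (count_space UNIV)"
      by measurable
    then show ?case
      by (simp add: axis_def eq_commute)
  qed simp
  have "{w \<in> space (steps p). walk w n $ l = N $ l \<and> walk w (n - 1) $ l = N $ l - 1 \<and>
     (\<forall>k\<in>UNIV. k \<noteq> l \<longrightarrow> walk w n $ k < N $ k)} \<in> sets (steps p)" for n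
    by measurable
  then show ?thesis
    unfolding wins_def by (intro sets.countable_UN') (auto simp: sp)
qed

end

theory Submission
  imports Defs
begin

text \<open>
  On the simplex the winning probability of player l is the polynomial W(s) obtained from the first
  step recursion W(s) = sum over k of p_k * W(s - e_k), where s counts the points still missing, and
  W decreases when an opponent k gets a point for free.

  Injectivity: for p \<noteq> q choose l maximizing r = p_l / q_l. Since r * q_k = p_k + d_k with d_k \<ge> 0 and
  d_l = 0, a step under q is a step under p mixed with free points for the opponents of l, so player l
  has a strictly smaller chance under q. The same argument for a tangent vector v, with l maximizing
  v_l / p_l, shows that the derivative of W_l along v is positive; hence the Jacobian is injective on
  the tangent space.

  Surjectivity: a face is mapped to itself and the interior to itself, so the image of the interior is
  open by invariance of domain and relatively closed by compactness; it is the whole interior by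
  connectedness, and the boundary follows by taking closures. The inverse is smooth by the inverse
  function theorem together with Cramer's rule.
\<close>

section \<open>The polynomial of a race\<close>

definition dec :: "'m \<Rightarrow> nat ^ 'm \<Rightarrow> nat ^ 'm::finite" where
  "dec k s = (\<chi> j. if j = k then s $ j - 1 else s $ j)"

lemma dec_nth [simp]: "dec k s $ j = (if j = k then s $ j - 1 else s $ j)"
  by (simp add: dec_def)

lemma dec_commute: "dec j (dec k s) = dec k (dec j s)"
  by (simp add: vec_eq_iff)

text \<open>
  Here s counts the missing points. The weights x are not normalized, so that race is a polynomial in
  x on the whole space. States with several zero entries do not occur in play; they count as lost
  for every player.
\<close>
function race :: "nat ^ 'm::finite \<Rightarrow> 'm \<Rightarrow> real ^ 'm \<Rightarrow> real" where
  "race s l x =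
    (if \<exists>k. k \<noteq> l \<and> s $ k = 0 then 0
     else if s $ l = 0 then 1
     else \<Sum>k\<in>UNIV. x $ k * race (dec k s) l x)"
  by pat_completeness auto
termination
proof (relation "Wellfounded.measure (\<lambda>(s, l, x). \<Sum>k\<in>UNIV. s $ k)", goal_cases)
  case (2 s l x k)
  then have "0 < s $ k" by (cases "k = l") auto
  then have "(\<Sum>j\<in>UNIV. dec k s $ j) < (\<Sum>j\<in>UNIV. s $ j)"
    by (intro sum_strict_mono_ex1 bexI[of _ k]) simp_all
  then show ?case by simp
qed simp

declare race.simps [simp del]

lemma race_lost: "k \<noteq> l \<Longrightarrow> s $ k = 0 \<Longrightarrow> race s l x = 0"
  by (subst race.simps) auto

lemma race_won:
  assumes "\<And>k. k \<noteq> l \<Longrightarrow> 0 < s $ k" "s $ l = 0"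
  shows "race s l x = 1"
proof -
  have "(\<exists>k. k \<noteq> l \<and> s $ k = 0) = False" using assms(1) less_irrefl by metis
  then show ?thesis by (subst race.simps) (simp only: assms(2) if_False simp_thms if_True)
qed

lemma race_step:
  assumes "\<And>k. 0 < s $ k"
  shows "race s l x = (\<Sum>k\<in>UNIV. x $ k * race (dec k s) l x)"
proof -
  have "(s $ k = 0) = False" for k using assms[of k] by simp
  then show ?thesis by (subst race.simps) (simp only: if_False simp_thms)
qed

text \<open>The cases follow the branches of \<open>race\<close>, but \<open>x\<close> stays out of
  the induction, so \<open>P\<close> may speak of \<open>race s l\<close> as a function;
  differentiability and smoothness need this.\<close>

lemma race_induct [case_names lost won step]:
  fixes s :: "nat ^ 'm::finite" and l :: 'm
  assumes lost: "\<And>s k. k \<noteq> l \<Longrightarrow> s $ k = 0 \<Longrightarrow> P s"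
    and won: "\<And>s. (\<And>k. k \<noteq> l \<Longrightarrow> 0 < s $ k) \<Longrightarrow> s $ l = 0 \<Longrightarrow> P s"
    and step: "\<And>s. (\<And>k. 0 < s $ k) \<Longrightarrow> (\<And>k. P (dec k s)) \<Longrightarrow> P s"
  shows "P s"
proof (induction "\<Sum>k\<in>UNIV. s $ k" arbitrary: s rule: less_induct)
  case less
  consider k where "k \<noteq> l" "s $ k = 0" | "\<And>k. k \<noteq> l \<Longrightarrow> 0 < s $ k" "s $ l = 0"
    | "\<And>k. 0 < s $ k"
    by (metis gr0I)
  then show ?case
  proof cases
    case 1
    then show ?thesis by (rule lost)
  next
    case 2
    then show ?thesis by (rule won)
  next
    case 3
    have "(\<Sum>j\<in>UNIV. dec k s $ j) < (\<Sum>j\<in>UNIV. s $ j)" for k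
      using 3[of k] by (intro sum_strict_mono_ex1 bexI[of _ k]) simp_all
    then show ?thesis using less.hyps by (intro step[OF 3]) blast
  qed
qed

lemma prob_simplex_iff: "p \<in> prob_simplex \<longleftrightarrow> (\<forall>k. 0 \<le> p $ k) \<and> (\<Sum>k\<in>UNIV. p $ k) = 1"
proof -
  have "p $ k \<le> 1" if "\<forall>k. 0 \<le> p $ k" "(\<Sum>k\<in>UNIV. p $ k) = 1" for k
    using member_le_sum[of k UNIV "\<lambda>k. p $ k"] that by simp
  then show ?thesis by (auto simp: prob_simplex_def)
qed

section \<open>Sign, bounds and total mass of the race polynomials\<close>

lemma race_nonneg:
  assumes "\<And>k. 0 \<le> x $ k"
  shows "0 \<le> race s l x"
proof (induction s rule: race_induct[of l])
  case (step s)
  then show ?case using assms by (simp add: race_step[OF step(1)] sum_nonneg)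
next
  case (lost s k)
  then show ?case by (simp add: race_lost[OF lost])
next
  case (won s)
  then show ?case by (simp add: race_won[OF won])
qed

lemma race_le_1:
  assumes "p \<in> prob_simplex"
  shows "race s l p \<le> 1"
proof (induction s rule: race_induct[of l])
  case (step s)
  have "(\<Sum>k\<in>UNIV. p $ k * race (dec k s) l p) \<le> (\<Sum>k\<in>UNIV. p $ k * 1)"
    using step(2) assms by (intro sum_mono mult_left_mono) (auto simp: prob_simplex_iff)
  then show ?case using assms step(1) by (simp add: prob_simplex_iff race_step[OF step(1)])
next
  case (lost s k)
  then show ?case by (simp add: race_lost[OF lost])
next
  case (won s)
  then show ?case by (simp add: race_won[OF won])
qed

text \<open>The path on which player l scores every remaining point has positive weight, and no path
  has negative weight.\<close>

lemma race_pos: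
  assumes "\<And>k. 0 \<le> x $ k" "0 < x $ l" "\<And>k. k \<noteq> l \<Longrightarrow> 0 < s $ k"
  shows "0 < race s l x"
  using assms(3)
proof (induction s rule: race_induct[of l])
  case (step s)
  have "0 < race (dec l s) l x"
    using step by auto
  then have "0 < (\<Sum>k\<in>UNIV. x $ k * race (dec k s) l x)"
    using assms by (intro sum_pos2[where i = l]) (auto simp: race_nonneg)
  then show ?case by (simp add: race_step[OF step(1)])
next
  case (lost s k)
  then show ?case by (metis less_numeral_extra(3))
next
  case (won s)
  then show ?case by (simp add: race_won[OF won(1,2)])
qed

text \<open>In the recursion the term \<open>k = l\<close> vanishes by its weight; the other terms
  leave \<open>s $ l\<close> positive and vanish by induction.\<close>

lemma race_eq_0:
  assumes "x $ l = 0" "0 < s $ l"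
  shows "race s l x = 0"
  using assms(2)
proof (induction s rule: race_induct[of l])
  case (step s)
  have "x $ k * race (dec k s) l x = 0" for k
    using step assms(1) by (cases "k = l") auto
  then show ?case by (subst race_step[OF step(1)]) (simp only: sum.neutral_const)
next
  case (lost s k)
  then show ?case by (simp add: race_lost[OF lost(1,2)])
qed simp

text \<open>At most one zero entry describes the states that can occur in play; with two zero
  entries the sum would be 0. The condition survives a step, which lowers a single entry of an
  all-positive state.\<close>

lemma sum_race:
  assumes "(\<Sum>k\<in>UNIV. x $ k) = 1" "\<And>j k. s $ j = 0 \<Longrightarrow> s $ k = 0 \<Longrightarrow> j = k"
  shows "(\<Sum>l\<in>UNIV. race s l x) = 1"
  using assms(2)
\<comment> \<open>The claim concerns all players at once, so the distinguished player is arbitrary;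
  the cases \<open>lost\<close> and \<open>won\<close> only tell which entry is zero.\<close>
proof (induction s rule: race_induct[of undefined])
  case (lost s k)
  then have pos: "0 < s $ j" if "j \<noteq> k" for j using that by (metis gr0I)
  have "race s l x = (if l = k then 1 else 0)" for l
    using lost pos by (cases "l = k") (auto simp: race_won race_lost[of k])
  then show ?case by simp
next
  case (won s)
  have "race s l x = (if l = undefined then 1 else 0)" for l
    using won by (cases "l = undefined") (auto simp: race_won race_lost[of undefined])
  then show ?case by simp
next
  case (step s)
  have "(\<Sum>l\<in>UNIV. race (dec k s) l x) = 1" for k
    using step(1) by (intro step(2)) (metis dec_nth less_numeral_extra(3))
  moreover have "(\<Sum>l\<in>UNIV. race s l x) = (\<Sum>k\<in>UNIV. x $ k * (\<Sum>l\<in>UNIV. race (dec k s) l x))"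
    by (simp add: race_step[OF step(1)] sum_distrib_left) (rule sum.swap)
  ultimately show ?case using assms(1) by simp
qed

section \<open>Free points for opponents and comparison of two weight vectors\<close>

text \<open>If the free point completes the race of k, the left side is 0. Otherwise both states are
  undecided and, since \<open>dec\<close> commutes, their recursions compare term by term.\<close>

lemma race_mono:
  assumes p: "p \<in> prob_simplex" and k: "k \<noteq> l"
  shows "race (dec k s) l p \<le> race s l p"
proof (induction s rule: race_induct[of l])
  case (lost s j)
  then have "dec k s $ j = 0" by (cases "j = k") auto
  with lost show ?case by (simp add: race_lost[of j])
next
  case (won s)
  then show ?case using race_le_1[OF p] by (simp add: race_won[OF won])
next
  case (step s)
  show ?case
  proof (cases "s $ k = 1")
    case True
    then have "race (dec k s) l p = 0" using k by (intro race_lost[of k]) simp_all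
    then show ?thesis using p by (simp add: race_nonneg prob_simplex_iff)
  next
    case False
    have pos: "0 < dec k s $ j" for j
      using step(1)[of j] False by auto
    then show ?thesis using p step
      by (auto simp: race_step[OF step(1)] race_step[OF pos] dec_commute[of _ k s] prob_simplex_iff
          intro!: sum_mono mult_left_mono)
  qed
qed

text \<open>Induction on \<open>s $ k\<close>: the summand \<open>j = k\<close> of the recursion has
  positive weight and carries the strict inequality, the other summands use
  \<open>race_mono\<close>. The descent ends at \<open>s $ k = 1\<close>, where the free point makes
  l lose while \<open>race_pos\<close> keeps the right side positive.\<close>

lemma race_strict_mono:
  assumes p: "p \<in> prob_simplex" and k: "k \<noteq> l" "0 < p $ k" "0 < p $ l"
    and "\<And>j. 0 < s $ j"
  shows "race (dec k s) l p < race s l p"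
  using assms(5)
proof (induction "s $ k" arbitrary: s)
  case 0
  then show ?case by (metis less_numeral_extra(3))
next
  case (Suc n)
  note s1 = Suc.prems
  show ?case
  proof (cases "s $ k = 1")
    case True
    then have "race (dec k s) l p = 0" using k by (intro race_lost[of k]) simp_all
    then show ?thesis using p k s1 by (simp add: race_pos prob_simplex_iff)
  next
    case False
    have pos: "0 < dec k s $ j" for j
      using s1[of j] False by auto
    have "race (dec k (dec k s)) l p < race (dec k s) l p"
      using pos Suc(2) by (intro Suc.hyps(1)) auto
    then have "(\<Sum>j\<in>UNIV. p $ j * race (dec k (dec j s)) l p)
        < (\<Sum>j\<in>UNIV. p $ j * race (dec j s) l p)"
      using p k race_mono[OF p k(1)]
      by (intro sum_strict_mono_ex1) (auto simp: prob_simplex_iff mult_left_mono intro!: exI[of _ k])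
    then show ?thesis by (simp add: race_step[OF s1] race_step[OF pos] dec_commute[of _ k s])
  qed
qed

context
  fixes p q :: "real ^ 'm::finite" and r :: real and l :: 'm
  assumes p: "p \<in> prob_simplex" and q: "q \<in> prob_simplex"
    and le: "\<And>k. p $ k \<le> r * q $ k" and eq: "p $ l = r * q $ l"
begin

text \<open>
  The weights r * q_k - p_k are nonnegative and vanish for k = l, so race_mono makes the left-hand side
  nonnegative.
\<close>
lemma race_compare_aux:
  assumes s: "\<And>k. 0 < s $ k" and IH: "\<And>k. race (dec k s) l q \<le> race (dec k s) l p"
  shows "(\<Sum>k\<in>UNIV. (r * q $ k - p $ k) * (race s l q - race (dec k s) l q))
    \<le> race s l p - race s l q"
proof -
  have "(\<Sum>k\<in>UNIV. (r * q $ k - p $ k) * (race s l q - race (dec k s) l q))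
    = (\<Sum>k\<in>UNIV. r * q $ k - p $ k) * race s l q
      - r * (\<Sum>k\<in>UNIV. q $ k * race (dec k s) l q) + (\<Sum>k\<in>UNIV. p $ k * race (dec k s) l q)"
    by (simp add: algebra_simps sum_distrib_left sum_distrib_right sum.distrib sum_subtractf)
  \<comment> \<open>The coefficient \<open>r - 1\<close> found here and the \<open>- r\<close> of
    the next sum combine to a single \<open>- race s l q\<close>.\<close>
  also have "(\<Sum>k\<in>UNIV. r * q $ k - p $ k) = r - 1"
    using p q by (simp add: prob_simplex_iff sum_subtractf flip: sum_distrib_left)
  also have "(\<Sum>k\<in>UNIV. q $ k * race (dec k s) l q) = race s l q"
    by (simp add: race_step[OF s])
  also have "(\<Sum>k\<in>UNIV. p $ k * race (dec k s) l q) \<le> race s l p"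
    using IH p by (auto simp: race_step[OF s] prob_simplex_iff intro!: sum_mono mult_left_mono)
  finally show ?thesis by (simp add: algebra_simps)
qed

text \<open>Proved for all states, decided ones included, so that it can later supply the hypothesis
  \<open>IH\<close> of \<open>race_compare_aux\<close>.\<close>

lemma race_compare: "race s l q \<le> race s l p"
proof (induction s rule: race_induct[of l])
  case (step s)
  have "0 \<le> (r * q $ k - p $ k) * (race s l q - race (dec k s) l q)" for k
    using le[of k] eq race_mono[OF q] by (cases "k = l") auto
  then have "0 \<le> (\<Sum>k\<in>UNIV. (r * q $ k - p $ k) * (race s l q - race (dec k s) l q))"
    by (simp add: sum_nonneg)
  with race_compare_aux[OF step] show ?case by simp
next
  case (lost s k)
  then show ?case by (simp add: race_lost[OF lost])
next
  case (won s)
  then show ?case by (simp add: race_won[OF won])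
qed

text \<open>One strict inequality suffices: by \<open>race_strict_mono\<close> its term makes the
  sum in \<open>race_compare_aux\<close> positive.\<close>

lemma race_compare_strict:
  assumes s: "\<And>k. 0 < s $ k" and k: "p $ k < r * q $ k" and l: "0 < q $ l"
  shows "race s l q < race s l p"
proof -
  have kl: "k \<noteq> l" and "q $ k \<noteq> 0" using k eq p by (auto simp: prob_simplex_iff simp flip: not_le)
  then have "0 < q $ k" using q by (simp add: prob_simplex_iff order_less_le)
  then have "0 < (r * q $ k - p $ k) * (race s l q - race (dec k s) l q)"
    using race_strict_mono[OF q kl _ l s] k by simp
  moreover have "0 \<le> (r * q $ k - p $ k) * (race s l q - race (dec k s) l q)" for k
    using le[of k] eq race_mono[OF q] by (cases "k = l") auto
  ultimately have "0 < (\<Sum>k\<in>UNIV. (r * q $ k - p $ k) * (race s l q - race (dec k s) l q))"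
    by (intro sum_pos2[where i = k]) auto
  also have "\<dots> \<le> race s l p - race s l q"
    by (intro race_compare_aux s race_compare)
  finally show ?thesis by simp
qed

end

lemma obtain_argmax:
  fixes f :: "'a \<Rightarrow> 'b::linorder"
  assumes "finite A" "A \<noteq> {}"
  obtains x where "x \<in> A" "\<And>y. y \<in> A \<Longrightarrow> f y \<le> f x"
proof -
  have "Max (f ` A) \<in> f ` A" using assms by simp
  then obtain x where "x \<in> A" "f x = Max (f ` A)" by force
  then show thesis using assms that by simp
qed

lemma race_inj:
  fixes p q :: "real ^ 'm::finite"
  assumes p: "p \<in> prob_simplex" and q: "q \<in> prob_simplex" and s: "\<And>k. 0 < s $ k"
    and eq: "\<And>l. race s l p = race s l q"
  shows "p = q"
proof (rule ccontr)
  assume "p \<noteq> q"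
  \<comment> \<open>Ratios exist only on the support of q. Outside it player k never wins under q,
    hence never under p, which by \<open>race_pos\<close> forces the weight under p to be 0 as
    well.\<close>
  have supp: "p $ k = 0" if "q $ k = 0" for k
    using race_eq_0[where x = q, OF that s] race_pos[of p k s] p s eq[of k]
    by (metis less_irrefl order_less_le prob_simplex_iff)
  have ne: "{k. 0 < q $ k} \<noteq> {}"
  proof
    assume "{k. 0 < q $ k} = {}"
    then have "q $ k = 0" for k using q by (auto simp: prob_simplex_iff order_less_le)
    then show False using q by (simp add: prob_simplex_iff)
  qed
  then obtain l where l: "0 < q $ l" "\<And>k. 0 < q $ k \<Longrightarrow> p $ k / q $ k \<le> p $ l / q $ l"
    using ne obtain_argmax[of "{k. 0 < q $ k}" "\<lambda>k. p $ k / q $ k"] by (metis finite mem_Collect_eq)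
  define r where "r = p $ l / q $ l"
  have le: "p $ k \<le> r * q $ k" for k
  proof (cases "0 < q $ k")
    case True
    then show ?thesis using l(2)[OF True] by (simp add: r_def pos_divide_le_eq)
  next
    case False
    then have "q $ k = 0" using q by (auto simp: prob_simplex_iff order_less_le)
    then show ?thesis using supp by simp
  qed
  have lr: "p $ l = r * q $ l" using l by (simp add: r_def)
  \<comment> \<open>Proportional points of the simplex coincide, as both coordinate sums are
    1.\<close>
  have "\<exists>k. p $ k \<noteq> r * q $ k"
  proof (rule ccontr)
    assume "\<nexists>k. p $ k \<noteq> r * q $ k"
    then have *: "p $ k = r * q $ k" for k by simp
    then have "r = 1" using p q by (simp add: prob_simplex_iff flip: sum_distrib_left)
    with * have "p = q" by (simp add: vec_eq_iff)
    with \<open>p \<noteq> q\<close> show False by simp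
  qed
  then obtain k where "p $ k < r * q $ k" using le order_less_le by blast
  then have "race s l q < race s l p"
    using race_compare_strict[OF p q le lr s] l by blast
  with eq show False by simp
qed

section \<open>Derivatives of the race polynomials along tangent vectors of the simplex\<close>

lemma race_differentiable: "race s l differentiable (at x)"
proof (induction s rule: race_induct[of l])
  case (lost s k)
  then have "race s l = (\<lambda>x. 0)" by (auto simp: race_lost[OF lost])
  then show ?case by simp
next
  case (won s)
  then have "race s l = (\<lambda>x. 1)" by (auto simp: race_won[OF won])
  then show ?case by simp
next
  case (step s)
  then have "race s l = (\<lambda>x. \<Sum>k\<in>UNIV. x $ k * race (dec k s) l x)" by (auto simp: race_step[OF step(1)])
  moreover have "(\<lambda>x :: real ^ 'a. x $ k) differentiable (at x)" for k
    by (intro bounded_linear_imp_differentiable bounded_linear_vec_nth)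
  ultimately show ?case using step(2) by (simp add: differentiable_sum differentiable_mult)
qed

lemma race_derivative_step:
  assumes "\<And>k. 0 < s $ k"
  shows "frechet_derivative (race s l) (at x) v =
    (\<Sum>k\<in>UNIV. x $ k * frechet_derivative (race (dec k s) l) (at x) v
      + v $ k * race (dec k s) l x)"
proof -
  have eq: "race s l = (\<lambda>x. \<Sum>k\<in>UNIV. x $ k * race (dec k s) l x)"
    by (auto simp: race_step[OF assms])
  have "(race s l has_derivative (\<lambda>v. \<Sum>k\<in>UNIV. x $ k * frechet_derivative (race (dec k s) l) (at x) v
      + v $ k * race (dec k s) l x)) (at x)"
    unfolding eq
    by (intro has_derivative_sum has_derivative_mult bounded_linear_imp_has_derivative
        bounded_linear_vec_nth race_differentiable[unfolded frechet_derivative_works])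
  from fun_cong[OF frechet_derivative_at[OF this], of v] show ?thesis by (rule sym)
qed

context
  fixes p v :: "real ^ 'm::finite" and r :: real and l :: 'm
  assumes p: "p \<in> prob_simplex" and v: "(\<Sum>k\<in>UNIV. v $ k) = 0"
    and le: "\<And>k. v $ k \<le> r * p $ k" and eq: "v $ l = r * p $ l"
begin

text \<open>Infinitesimal counterpart of \<open>race_compare_aux\<close>, now an identity. The
  weights \<open>r * p $ k - v $ k\<close> sum to r, so the multiples of \<open>race s l p\<close>
  cancel and the product rule term with the weights \<open>v $ k\<close> remains.\<close>

lemma race_derivative_aux:
  assumes s: "\<And>k. 0 < s $ k"
  shows "frechet_derivative (race s l) (at p) v =
    (\<Sum>k\<in>UNIV. p $ k * frechet_derivative (race (dec k s) l) (at p) v)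
    + (\<Sum>k\<in>UNIV. (r * p $ k - v $ k) * (race s l p - race (dec k s) l p))"
proof -
  have "(\<Sum>k\<in>UNIV. (r * p $ k - v $ k) * (race s l p - race (dec k s) l p))
    = (\<Sum>k\<in>UNIV. r * p $ k - v $ k) * race s l p
      - r * (\<Sum>k\<in>UNIV. p $ k * race (dec k s) l p) + (\<Sum>k\<in>UNIV. v $ k * race (dec k s) l p)"
    by (simp add: algebra_simps sum_distrib_left sum_distrib_right sum.distrib sum_subtractf)
  also have "(\<Sum>k\<in>UNIV. r * p $ k - v $ k) = r"
    using p v by (simp add: prob_simplex_iff sum_subtractf flip: sum_distrib_left)
  also have "(\<Sum>k\<in>UNIV. p $ k * race (dec k s) l p) = race s l p"
    by (simp add: race_step[OF s])
  finally show ?thesis by (simp add: race_derivative_step[OF s] sum.distrib)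
qed

lemma race_derivative_terms_nonneg:
  "0 \<le> (r * p $ k - v $ k) * (race s l p - race (dec k s) l p)"
  using le[of k] eq race_mono[OF p] by (cases "k = l") auto

lemma race_derivative_nonneg: "0 \<le> frechet_derivative (race s l) (at p) v"
proof (induction s rule: race_induct[of l])
  case (step s)
  then show ?case using p
    by (simp add: race_derivative_aux[OF step(1)] prob_simplex_iff race_derivative_terms_nonneg sum_nonneg)
next
  case (lost s k)
  then have "race s l = (\<lambda>x. 0)" by (auto simp: race_lost[OF lost])
  then show ?case by simp
next
  case (won s)
  then have "race s l = (\<lambda>x. 1)" by (auto simp: race_won[OF won])
  then show ?case by simp
qed

lemma race_derivative_pos:
  assumes s: "\<And>k. 0 < s $ k" and k: "v $ k < r * p $ k" and pos: "0 < p $ k" "0 < p $ l"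
  shows "0 < frechet_derivative (race s l) (at p) v"
proof -
  have kl: "k \<noteq> l" using k eq by auto
  then have "0 < (r * p $ k - v $ k) * (race s l p - race (dec k s) l p)"
    using race_strict_mono[OF p kl pos s] k by simp
  then have "0 < (\<Sum>k\<in>UNIV. (r * p $ k - v $ k) * (race s l p - race (dec k s) l p))"
    using race_derivative_terms_nonneg by (intro sum_pos2[where i = k]) auto
  moreover have "0 \<le> (\<Sum>k\<in>UNIV. p $ k * frechet_derivative (race (dec k s) l) (at p) v)"
    using p by (simp add: prob_simplex_iff race_derivative_nonneg sum_nonneg)
  ultimately show ?thesis by (simp add: race_derivative_aux[OF s])
qed

end

text \<open>The player l maximizing \<open>v $ l / p $ l\<close> works. A nonzero v with coordinate
  sum 0 is not a multiple of p, so some ratio lies strictly below the maximum.\<close>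

lemma ex_race_derivative_pos:
  fixes p v :: "real ^ 'm::finite"
  assumes p: "p \<in> prob_simplex" "\<And>k. 0 < p $ k" and s: "\<And>k. 0 < s $ k"
    and v: "(\<Sum>k\<in>UNIV. v $ k) = 0" "v \<noteq> 0"
  shows "\<exists>l. 0 < frechet_derivative (race s l) (at p) v"
proof -
  obtain l where l: "\<And>k. v $ k / p $ k \<le> v $ l / p $ l"
    using obtain_argmax[of UNIV "\<lambda>k. v $ k / p $ k"] by auto
  define r where "r = v $ l / p $ l"
  have le: "v $ k \<le> r * p $ k" for k
    using l[of k] p(2)[of k] by (simp add: r_def pos_divide_le_eq)
  have eq: "v $ l = r * p $ l" using p(2)[of l] by (simp add: r_def)
  have "\<exists>k. v $ k \<noteq> r * p $ k"
  proof (rule ccontr)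
    assume "\<nexists>k. v $ k \<noteq> r * p $ k"
    then have *: "v $ k = r * p $ k" for k by simp
    then have "r = 0" using p(1) v by (simp add: prob_simplex_iff flip: sum_distrib_left)
    with * have "v = 0" by (simp add: vec_eq_iff)
    with v(2) show False by simp
  qed
  then obtain k where "v $ k < r * p $ k" using le order_less_le by blast
  then show ?thesis using race_derivative_pos[OF p(1) v(1) le eq s _ p(2) p(2)] by blast
qed

section \<open>Smooth maps and their local inverses\<close>

text \<open>On an open set equal functions have equal derivatives at each point, so the agreement
  passes to all directional derivatives.\<close>

lemma Ck_on_cong:
  assumes "open S" "\<And>x. x \<in> S \<Longrightarrow> f x = g x" "Ck_on k S f"
  shows "Ck_on k S g"
  using assms(2,3)
proof (induction k arbitrary: f g)
  case 0
  then show ?case by (simp cong: continuous_on_cong)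
next
  case (Suc k)
  have D: "(g has_derivative frechet_derivative f (at x)) (at x)" if "x \<in> S" for x
    using Suc.prems that assms(1)
    by (auto simp: frechet_derivative_works intro: has_derivative_transform_within_open)
  have "Ck_on k S (\<lambda>x. frechet_derivative g (at x) v)" for v
  proof (rule Suc.IH)
    show "frechet_derivative f (at x) v = frechet_derivative g (at x) v" if "x \<in> S" for x
      by (rule fun_cong[OF frechet_derivative_at[OF D[OF that]]])
    show "Ck_on k S (\<lambda>x. frechet_derivative f (at x) v)" using Suc.prems(2) by simp
  qed
  moreover have "g differentiable (at x)" if "x \<in> S" for x
    using D[OF that] by (auto simp: differentiable_def)
  ultimately show ?case by simp
qed

text \<open>Allows explicit derivative formulas, valid on S only, in place of
  \<open>frechet_derivative\<close>.\<close>

lemma Ck_on_SucI: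
  assumes "open S" "\<And>x. x \<in> S \<Longrightarrow> (f has_derivative f' x) (at x)" "\<And>v. Ck_on k S (\<lambda>x. f' x v)"
  shows "Ck_on (Suc k) S f"
proof -
  have "Ck_on k S (\<lambda>x. frechet_derivative f (at x) v)" for v
    using frechet_derivative_at[OF assms(2)] by (intro Ck_on_cong[OF assms(1) _ assms(3)[of v]]) auto
  then show ?thesis using assms(2) by (auto simp: differentiable_def)
qed

lemma Ck_on_imp_continuous_on: "Ck_on k S f \<Longrightarrow> continuous_on S f"
  by (cases k) (auto simp: continuous_at_imp_continuous_on differentiable_imp_continuous_within)

lemma Ck_on_SucD: "Ck_on (Suc k) S f \<Longrightarrow> Ck_on k S f"
proof (induction k arbitrary: f)
  case 0
  then show ?case by (simp only: Ck_on.simps(1)) (rule Ck_on_imp_continuous_on)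
qed simp

lemma Ck_on_derivative: "Ck_on (Suc k) S f \<Longrightarrow> Ck_on k S (\<lambda>x. frechet_derivative f (at x) v)"
  by simp

lemma Ck_on_const: "Ck_on k S (\<lambda>x. c)"
  by (induction k arbitrary: c) auto

lemma has_derivative_Ck_on:
  "Ck_on (Suc k) S f \<Longrightarrow> x \<in> S \<Longrightarrow> (f has_derivative frechet_derivative f (at x)) (at x)"
  by (auto simp: frechet_derivative_works)

lemma Ck_on_bounded_linear:
  assumes "open S" "bounded_linear h" "Ck_on k S f"
  shows "Ck_on k S (\<lambda>x. h (f x))"
  using assms(3)
proof (induction k arbitrary: f)
  case 0
  then show ?case by (simp add: bounded_linear.continuous_on[OF assms(2)])
next
  case (Suc k)
  show ?case
    by (rule Ck_on_SucI[OF assms(1) bounded_linear.has_derivative[OF assms(2) has_derivative_Ck_on[OF Suc.prems]]])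
      (assumption, intro Suc.IH Ck_on_derivative Suc.prems)
qed

lemma Ck_on_ident: "open S \<Longrightarrow> Ck_on k S (\<lambda>x. x)"
  by (cases k) (auto intro!: Ck_on_SucI Ck_on_const has_derivative_ident)

lemma Ck_on_add:
  assumes "open S" "Ck_on k S f" "Ck_on k S g"
  shows "Ck_on k S (\<lambda>x. f x + g x)"
  using assms(2,3)
proof (induction k arbitrary: f g)
  case (Suc k)
  show ?case
    by (rule Ck_on_SucI[OF assms(1) has_derivative_add[OF
            has_derivative_Ck_on[OF Suc.prems(1)] has_derivative_Ck_on[OF Suc.prems(2)]]])
      (assumption, assumption, intro Suc.IH Ck_on_derivative Suc.prems)
qed (auto intro: continuous_on_add)

lemma Ck_on_sum:
  assumes "open S" "\<And>i. i \<in> I \<Longrightarrow> Ck_on k S (f i)"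
  shows "Ck_on k S (\<lambda>x. \<Sum>i\<in>I. f i x)"
  using assms(2) by (induction I rule: infinite_finite_induct) (auto intro!: Ck_on_add Ck_on_const assms(1))

lemma Ck_on_scaleR:
  fixes f :: "'a::euclidean_space \<Rightarrow> real" and g :: "'a \<Rightarrow> 'b::euclidean_space"
  assumes "open S" "Ck_on k S f" "Ck_on k S g"
  shows "Ck_on k S (\<lambda>x. f x *\<^sub>R g x)"
  using assms(2,3)
proof (induction k arbitrary: f g)
  case (Suc k)
  show ?case
    by (rule Ck_on_SucI[OF assms(1) has_derivative_scaleR[OF
            has_derivative_Ck_on[OF Suc.prems(1)] has_derivative_Ck_on[OF Suc.prems(2)]]])
      (assumption, assumption, intro Ck_on_add assms(1) Suc.IH Ck_on_SucD[OF Suc.prems(1)]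
        Ck_on_SucD[OF Suc.prems(2)] Ck_on_derivative Suc.prems)
qed (auto intro: continuous_on_scaleR)

lemma Ck_on_mult:
  fixes f g :: "'a::euclidean_space \<Rightarrow> real"
  shows "open S \<Longrightarrow> Ck_on k S f \<Longrightarrow> Ck_on k S g \<Longrightarrow> Ck_on k S (\<lambda>x. f x * g x)"
  using Ck_on_scaleR[of S k f g] by simp

lemma Ck_on_prod:
  fixes f :: "'i \<Rightarrow> 'a::euclidean_space \<Rightarrow> real"
  assumes "open S" "\<And>i. i \<in> I \<Longrightarrow> Ck_on k S (f i)"
  shows "Ck_on k S (\<lambda>x. \<Prod>i\<in>I. f i x)"
  using assms(2) by (induction I rule: infinite_finite_induct) (auto intro!: Ck_on_mult Ck_on_const assms(1))

text \<open>The derivative of the reciprocal contains the reciprocal itself, but only to the order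
  supplied by the induction.\<close>

lemma Ck_on_inverse:
  fixes f :: "'a::euclidean_space \<Rightarrow> real"
  assumes "open S" "Ck_on k S f" "\<And>x. x \<in> S \<Longrightarrow> f x \<noteq> 0"
  shows "Ck_on k S (\<lambda>x. inverse (f x))"
  using assms(2)
proof (induction k)
  case (Suc k)
  have "Ck_on k S (\<lambda>x. inverse (f x))" using Suc Ck_on_SucD by blast
  moreover have "Ck_on k S (\<lambda>x. frechet_derivative f (at x) v)" for v by (intro Ck_on_derivative Suc.prems)
  ultimately show ?case
    by (intro Ck_on_SucI[OF assms(1) Deriv.has_derivative_inverse[OF assms(3) has_derivative_Ck_on[OF Suc.prems]]]
        Ck_on_bounded_linear[OF assms(1) bounded_linear_minus[OF bounded_linear_ident]] Ck_on_mult assms(1))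
qed (use assms(3) in \<open>auto intro: continuous_on_inverse\<close>)

lemma Ck_on_divide:
  fixes f g :: "'a::euclidean_space \<Rightarrow> real"
  assumes "open S" "Ck_on k S f" "Ck_on k S g" "\<And>x. x \<in> S \<Longrightarrow> g x \<noteq> 0"
  shows "Ck_on k S (\<lambda>x. f x / g x)"
  using Ck_on_mult[OF assms(1,2) Ck_on_inverse[OF assms(1,3,4)]] by (simp add: divide_inverse)

lemma Ck_on_compose:
  fixes g :: "'a::euclidean_space \<Rightarrow> 'b::euclidean_space" and h :: "'b \<Rightarrow> 'c::euclidean_space"
  assumes "open S" "g ` S \<subseteq> T" "Ck_on k S g" "Ck_on k T h"
  shows "Ck_on k S (\<lambda>x. h (g x))"
  using assms(3,4)
proof (induction k arbitrary: h)
  case 0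
  then show ?case using assms(2) by (auto intro: continuous_on_compose2)
next
  case (Suc k)
  have gT: "g x \<in> T" if "x \<in> S" for x using that assms(2) by blast
  \<comment> \<open>In the chain rule the direction fed to the derivative of h varies with x,
    whereas \<open>Ck_on\<close> speaks of fixed directions. Expanding it in the basis separates the
    two.\<close>
  let ?f' = "\<lambda>x v. \<Sum>b\<in>Basis. (frechet_derivative g (at x) v \<bullet> b) *\<^sub>R frechet_derivative h (at (g x)) b"
  show ?case
  proof (rule Ck_on_SucI[OF assms(1)])
    fix x assume x: "x \<in> S"
    note hd = has_derivative_Ck_on[OF Suc.prems(2) gT[OF x]]
    have "((\<lambda>x. h (g x)) has_derivative (\<lambda>v. frechet_derivative h (at (g x)) (frechet_derivative g (at x) v))) (at x)"
      by (rule has_derivative_compose[OF has_derivative_Ck_on[OF Suc.prems(1) x] hd])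
    moreover have "frechet_derivative h (at (g x)) w
        = (\<Sum>b\<in>Basis. (w \<bullet> b) *\<^sub>R frechet_derivative h (at (g x)) b)" for w
      using linear_sum[OF has_derivative_linear[OF hd], of "\<lambda>b. (w \<bullet> b) *\<^sub>R b" Basis]
      by (simp add: euclidean_representation linear_scale[OF has_derivative_linear[OF hd]])
    ultimately show "((\<lambda>x. h (g x)) has_derivative ?f' x) (at x)"
      by (elim has_derivative_eq_rhs) (rule ext)
  next
    fix v
    have "Ck_on k S (\<lambda>x. frechet_derivative g (at x) v)" by (intro Ck_on_derivative Suc.prems)
    moreover have "Ck_on k S (\<lambda>x. frechet_derivative h (at (g x)) b)" for b
      by (intro Suc.IH[where h = "\<lambda>y. frechet_derivative h (at y) b"] Ck_on_SucD[OF Suc.prems(1)]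
          Ck_on_derivative Suc.prems)
    ultimately show "Ck_on k S (\<lambda>x. ?f' x v)"
      by (intro Ck_on_sum Ck_on_scaleR assms(1) Ck_on_bounded_linear[OF _ bounded_linear_inner_left])
  qed
qed

lemma Ck_on_vec:
  fixes f :: "'a::euclidean_space \<Rightarrow> real ^ 'n"
  assumes "open S" "\<And>i. Ck_on k S (\<lambda>x. f x $ i)"
  shows "Ck_on k S f"
proof -
  have "Ck_on k S (\<lambda>x. \<Sum>i\<in>UNIV. f x $ i *\<^sub>R (axis i 1 :: real ^ 'n))"
    by (intro Ck_on_sum Ck_on_scaleR assms Ck_on_const)
  then show ?thesis by (simp add: basis_expansion flip: scalar_mult_eq_scaleR)
qed

lemma Ck_on_det:
  fixes A :: "'a::euclidean_space \<Rightarrow> real ^ 'n ^ 'n"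
  assumes "open S" "\<And>i j. Ck_on k S (\<lambda>x. A x $ i $ j)"
  shows "Ck_on k S (\<lambda>x. det (A x))"
  unfolding det_def by (intro Ck_on_sum Ck_on_mult Ck_on_prod assms Ck_on_const)

text \<open>The inverse function theorem yields a differentiable inverse g, and higher orders follow
  by bootstrapping: the derivative of g at y is a rational expression in the partial derivatives of
  f at \<open>g y\<close>, so it is C^k as soon as g is, which makes g C^(k+1).\<close>

theorem smooth_inverse_function:
  fixes f :: "real ^ 'n \<Rightarrow> real ^ 'n"
  assumes U: "open U" and f: "\<And>k. Ck_on k U f" and x0: "x0 \<in> U"
    and inj: "inj (frechet_derivative f (at x0))"
  obtains U' V g where "open U'" "U' \<subseteq> U" "x0 \<in> U'" "open V" "f x0 \<in> V" "homeomorphism U' V f g"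
    "\<And>k. Ck_on k V g"
proof -
  \<comment> \<open>\<open>inverse_function_theorem\<close> asks for continuity in operator norm,
    hence the bundling by \<open>Blinfun\<close>; in finite dimension continuity in each direction
    suffices.\<close>
  define f' where "f' x = Blinfun (frechet_derivative f (at x))" for x
  have df: "(f has_derivative frechet_derivative f (at x)) (at x)" if "x \<in> U" for x
    using has_derivative_Ck_on[OF f that] .
  have f': "blinfun_apply (f' x) = frechet_derivative f (at x)" if "x \<in> U" for x
    using df[OF that] by (simp add: f'_def bounded_linear_Blinfun_apply has_derivative_bounded_linear)
  have df': "(f has_derivative blinfun_apply (f' x)) (at x)" if "x \<in> U" for x
    using df f' that by simp
  have cf': "continuous_on U f'"
  proof (rule continuous_on_blinfun_componentwise)
    fix i :: "real ^ 'n"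
    have "continuous_on U (\<lambda>x. frechet_derivative f (at x) i)"
      using f[of "Suc 0"] by simp
    then show "continuous_on U (\<lambda>x. blinfun_apply (f' x) i)" by (simp add: f' cong: continuous_on_cong)
  qed
  obtain L where L: "linear L" "L \<circ> frechet_derivative f (at x0) = id"
    using linear_injective_left_inverse[OF has_derivative_linear[OF df[OF x0]] inj] by blast
  have "Blinfun L o\<^sub>L f' x0 = id_blinfun"
    using L x0 by (intro blinfun_eqI)
      (simp add: f' bounded_linear_Blinfun_apply linear_conv_bounded_linear fun_eq_iff)
  from inverse_function_theorem[OF U df' cf' x0 this]
  obtain U' V g g' where U': "open U'" "U' \<subseteq> U" "x0 \<in> U'" and V: "open V" "f x0 \<in> V"
    and hom: "homeomorphism U' V f g"
    and dg: "\<And>y. y \<in> V \<Longrightarrow> (g has_derivative g' y) (at y)"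
    and g': "\<And>y. y \<in> V \<Longrightarrow> g' y = inv (blinfun_apply (f' (g y)))"
    and bij: "\<And>y. y \<in> V \<Longrightarrow> bij (blinfun_apply (f' (g y)))"
    by metis
  have gV: "g ` V \<subseteq> U" using hom U'(2) by (auto simp: homeomorphism_def)
  define A where "A y = matrix (frechet_derivative f (at (g y)))" for y
  have A: "A y *v w = frechet_derivative f (at (g y)) w" if "y \<in> V" for y w
    unfolding A_def using gV that has_derivative_linear[OF df, of "g y"]
    by (intro matrix_works) (auto simp: linear_matrix_vector_mul_eq)
  have det: "det (A y) \<noteq> 0" if "y \<in> V" for y
  proof -
    have "inj ((*v) (A y))"
      using bij[OF that] gV that by (auto simp: A[OF that] bij_def f' inj_on_def)
    then show ?thesis by (simp add: invertible_det_nz flip: invertible_left_inverse matrix_left_invertible_injective)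
  qed
  \<comment> \<open>Cramer's rule for the solution w of \<open>A y *v w = v\<close>: column i is
    replaced by v.\<close>
  define G where "G y v = (\<chi> i. det (\<chi> a b. if b = i then v $ a else A y $ a $ b) / det (A y))" for y v
  have G: "g' y = G y" if "y \<in> V" for y
  proof
    fix v
    have "frechet_derivative f (at (g y)) (g' y v) = v"
      using bij[OF that] gV that f'[of "g y"] by (simp add: g' image_subset_iff bij_is_surj surj_f_inv_f)
    then have "A y *v g' y v = v" by (simp add: A that)
    then show "g' y v = G y v" using cramer[OF det[OF that]] by (simp add: G_def)
  qed
  have "Ck_on k V g" for k
  proof (induction k)
    case 0
    then show ?case using hom by (simp add: homeomorphism_def)
  next
    case (Suc k)
    have "Ck_on k V (\<lambda>y. frechet_derivative f (at (g y)) w)" for w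
      using f[of "Suc k"] by (intro Ck_on_compose[OF V(1) gV Suc]) simp
    then have "Ck_on k V (\<lambda>y. A y $ a $ b)" for a b
      unfolding A_def matrix_def
      by (simp add: Ck_on_bounded_linear[OF V(1) bounded_linear_vec_nth])
    note A_Ck = this
    have "Ck_on k V (\<lambda>y. if b = i then v $ a else A y $ a $ b)" for v a b i
      by (cases "b = i") (simp_all add: Ck_on_const A_Ck)
    then have "Ck_on k V (\<lambda>y. G y v)" for v
      unfolding G_def
      by (intro Ck_on_vec V(1)) (auto intro!: Ck_on_divide Ck_on_det V(1) det A_Ck)
    then show ?case
      using dg G by (intro Ck_on_SucI[OF V(1)]) auto
  qed
  with U' V hom show thesis using that by blast
qed

lemma Ck_on_race: "Ck_on k UNIV (race s l)"
proof (induction s rule: race_induct[of l])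
  case (lost s k)
  then have "race s l = (\<lambda>x. 0)" by (auto simp: race_lost[OF lost])
  then show ?case by (simp add: Ck_on_const)
next
  case (won s)
  then have "race s l = (\<lambda>x. 1)" by (auto simp: race_won[OF won])
  then show ?case by (simp add: Ck_on_const)
next
  case (step s)
  then have "race s l = (\<lambda>x. \<Sum>k\<in>UNIV. x $ k * race (dec k s) l x)" by (auto simp: race_step[OF step(1)])
  then show ?case using step(2)
    by (auto intro!: Ck_on_sum Ck_on_mult Ck_on_bounded_linear[OF _ bounded_linear_vec_nth] Ck_on_ident)
qed

section \<open>Winning probabilities as polynomials\<close>

lemma walk_case_nat: "walk (case_nat k w) (Suc n) = axis k 1 + walk w n"
  by (induction n) (simp_all add: add.assoc)

lemma walk_Suc_nth: "walk w (Suc n) $ k = walk w n $ k + (if w n = k then 1 else 0)"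
  by (auto simp: axis_def)

lemma walk_mono: "m \<le> n \<Longrightarrow> walk w m $ k \<le> walk w n $ k"
  by (induction n rule: dec_induct) (simp_all add: axis_def)

text \<open>
  Unlike wins, this makes sense for s $ l = 0 too (player l has then won already), which the recursion
  over the first step needs.
\<close>
definition first_to :: "nat ^ 'm::finite \<Rightarrow> 'm \<Rightarrow> (nat \<Rightarrow> 'm) set" where
  "first_to s l = {w. \<exists>n. walk w n $ l = s $ l \<and> (\<forall>k. k \<noteq> l \<longrightarrow> walk w n $ k < s $ k)}"

text \<open>At the least time m with \<open>walk w m $ l = s $ l\<close> the last step was made by
  l, and m is positive because \<open>s $ l\<close> is. As m is at most the given time, monotonicity
  of the walk keeps the opponents below their targets.\<close>

lemma first_to_eq_wins:
  assumes "0 < s $ l"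
  shows "first_to s l = wins s l"
proof (intro equalityI subsetI)
  fix w assume "w \<in> first_to s l"
  then obtain n where n: "walk w n $ l = s $ l" "\<And>k. k \<noteq> l \<Longrightarrow> walk w n $ k < s $ k"
    by (auto simp: first_to_def)
  then obtain m where m: "walk w m $ l = s $ l" "\<And>j. j < m \<Longrightarrow> walk w j $ l \<noteq> s $ l"
    using exists_least_iff[of "\<lambda>m. walk w m $ l = s $ l"] by blast
  have mn: "m \<le> n" using m(2)[of n] n(1) by (meson not_le)
  have "m \<noteq> 0" using m(1) assms by (cases m) auto
  then obtain j where j: "m = Suc j" by (cases m) auto
  have "walk w j $ l \<noteq> s $ l" using m(2) j by simp
  then have "walk w j $ l = s $ l - 1"
    using m(1) unfolding j walk_Suc_nth by (auto split: if_splits)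
  moreover have "walk w m $ k < s $ k" if "k \<noteq> l" for k
    using n(2)[OF that] walk_mono[OF mn, of w k] by simp
  ultimately show "w \<in> wins s l" using m(1) j by (auto simp: wins_def intro!: bexI[of _ m])
qed (auto simp: wins_def first_to_def)

lemma first_to_lost: "k \<noteq> l \<Longrightarrow> s $ k = 0 \<Longrightarrow> first_to s l = {}"
  by (fastforce simp: first_to_def)

lemma first_to_won:
  assumes "\<And>k. k \<noteq> l \<Longrightarrow> 0 < s $ k" "s $ l = 0"
  shows "first_to s l = UNIV"
proof -
  have "walk w 0 $ l = s $ l \<and> (\<forall>k. k \<noteq> l \<longrightarrow> walk w 0 $ k < s $ k)" for w using assms by simp
  then show ?thesis unfolding first_to_def by blast
qed

text \<open>At time 0 player l still misses points, so every witnessing time is a successor and can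
  be counted from the second step on.\<close>

lemma first_to_step:
  assumes "\<And>k. 0 < s $ k"
  shows "case_nat j w \<in> first_to s l \<longleftrightarrow> w \<in> first_to (dec j s) l"
proof -
  have hit: "(axis j 1 + walk w n) $ l = s $ l \<longleftrightarrow> walk w n $ l = dec j s $ l" for n
    using assms[of l] by (auto simp: axis_def)
  have below: "(axis j 1 + walk w n) $ k < s $ k \<longleftrightarrow> walk w n $ k < dec j s $ k" for n k
    by (auto simp: axis_def)
  have ex_Suc: "(\<exists>n. P n) \<longleftrightarrow> (\<exists>n. P (Suc n))" if "\<not> P 0" for P
    using that by (metis not0_implies_Suc)
  have "case_nat j w \<in> first_to s l \<longleftrightarrow>
    (\<exists>n. walk (case_nat j w) (Suc n) $ l = s $ l \<and> (\<forall>k. k \<noteq> l \<longrightarrow> walk (case_nat j w) (Suc n) $ k < s $ k))"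
    unfolding first_to_def mem_Collect_eq by (rule ex_Suc) (use assms[of l] in simp)
  then show ?thesis
    unfolding walk_case_nat hit below by (simp add: first_to_def)
qed

lemma sets_first_to: "first_to s l \<in> sets (steps p)"
proof -
  have sp: "space (steps p) = UNIV" by (simp add: steps_def space_PiM)
  consider k where "k \<noteq> l" "s $ k = 0" | "\<And>k. k \<noteq> l \<Longrightarrow> 0 < s $ k" "s $ l = 0" | "0 < s $ l"
    by (metis gr0I)
  then show ?thesis
  proof cases
    case 1
    then show ?thesis by (simp add: first_to_lost)
  next
    case 2
    then show ?thesis using sets.top[of "steps p"] sp by (simp add: first_to_won[OF 2])
  next
    case 3
    then show ?thesis by (simp add: first_to_eq_wins sets_wins)
  qed
qed

text \<open>Conditioning on the first step: prepending an independent step to the sequence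
  reproduces its law (\<open>PiM_iter\<close>), and integrating out that step gives a finite
  sum.\<close>

lemma measure_steps_case_nat:
  fixes p :: "real ^ 'm::finite"
  assumes p: "p \<in> prob_simplex" and X: "X \<in> sets (steps p)"
  shows "measure (steps p) X = (\<Sum>k\<in>UNIV. p $ k * measure (steps p) {w. case_nat k w \<in> X})"
proof -
  interpret S: sequence_space "measure_pmf (step_pmf p)" by standard
  let ?f = "\<lambda>(k, w). case_nat k w"
  have S: "steps p = S.S" by (simp add: steps_def)
  have sp: "space (steps p) = UNIV" by (simp add: steps_def space_PiM)
  have f: "?f \<in> measurable (measure_pmf (step_pmf p) \<Otimes>\<^sub>M steps p) (steps p)"
    unfolding S by measurable
  have sec: "{w. case_nat k w \<in> X} \<in> sets (steps p)" for k
    using measurable_sets[OF measurable_compose[OF measurable_Pair1' f] X, of k]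
    by (simp add: vimage_def sp)
  have "emeasure (steps p) X = emeasure (distr (measure_pmf (step_pmf p) \<Otimes>\<^sub>M steps p) (steps p) ?f) X"
    using S.PiM_iter by (simp add: S)
  also have "\<dots> = emeasure (measure_pmf (step_pmf p) \<Otimes>\<^sub>M steps p)
      (?f -` X \<inter> space (measure_pmf (step_pmf p) \<Otimes>\<^sub>M steps p))"
    by (rule emeasure_distr[OF f X])
  also have "\<dots> = (\<integral>\<^sup>+k. emeasure (steps p) (Pair k -` (?f -` X \<inter> space (measure_pmf (step_pmf p) \<Otimes>\<^sub>M steps p)))
      \<partial>measure_pmf (step_pmf p))"
    unfolding S by (intro S.P.emeasure_pair_measure_alt measurable_sets[OF f[unfolded S] X[unfolded S]])
  also have "\<dots> = (\<integral>\<^sup>+k. emeasure (steps p) {w. case_nat k w \<in> X} \<partial>measure_pmf (step_pmf p))"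
    by (simp add: vimage_def space_pair_measure sp)
  also have "\<dots> = (\<Sum>k\<in>UNIV. emeasure (steps p) {w. case_nat k w \<in> X} * ennreal (p $ k))"
    using p by (subst nn_integral_measure_pmf_support[where A = UNIV]) (auto simp: pmf_step_pmf set_pmf_iff)
  also have "\<dots> = (\<Sum>k\<in>UNIV. ennreal (p $ k * measure (steps p) {w. case_nat k w \<in> X}))"
    using p by (simp add: S S.P.emeasure_eq_measure ennreal_mult'' mult.commute prob_simplex_iff)
  also have "\<dots> = ennreal (\<Sum>k\<in>UNIV. p $ k * measure (steps p) {w. case_nat k w \<in> X})"
    using p by (intro sum_ennreal) (simp add: prob_simplex_iff)
  finally have "ennreal (measure (steps p) X) = ennreal (\<Sum>k\<in>UNIV. p $ k * measure (steps p) {w. case_nat k w \<in> X})"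
    by (simp add: S S.P.emeasure_eq_measure)
  then show ?thesis
    using p by (subst (asm) ennreal_inj) (auto intro!: sum_nonneg simp: prob_simplex_iff)
qed

text \<open>Both sides have the same values at decided states and satisfy the same first step
  recursion.\<close>

lemma measure_first_to:
  fixes p :: "real ^ 'm::finite"
  assumes p: "p \<in> prob_simplex"
  shows "measure (steps p) (first_to s l) = race s l p"
proof (induction s rule: race_induct[of l])
  case (lost s k)
  then show ?case by (simp add: first_to_lost[OF lost] race_lost[OF lost])
next
  case (won s)
  interpret S: sequence_space "measure_pmf (step_pmf p)" by standard
  have "measure (steps p) UNIV = 1"
    using S.P.prob_space by (simp add: steps_def space_PiM)
  then show ?case by (simp add: first_to_won[OF won] race_won[OF won])
next
  case (step s)
  then show ?case
    by (simp add: measure_steps_case_nat[OF p sets_first_to] first_to_step[OF step(1)] race_step[OF step(1)])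
qed

lemma win_prob_eq_race:
  assumes "p \<in> prob_simplex" "\<And>k. 0 < N $ k"
  shows "win_prob N p $ l = race N l p"
  using measure_first_to[OF assms(1), of N l] by (simp add: win_prob_def first_to_eq_wins assms(2))

section \<open>The winning map on the simplex\<close>

lemma affine_sum_eq_1: "affine {x :: real ^ 'm::finite. (\<Sum>k\<in>UNIV. x $ k) = 1}"
  by (auto simp: affine_def sum.distrib simp flip: sum_distrib_left)

lemma axis_in_prob_simplex: "axis k 1 \<in> prob_simplex"
  by (auto simp: prob_simplex_iff axis_def)

text \<open>The vertices already span the hyperplane: the coordinates of x serve as its affine
  coefficients.\<close>

lemma affine_hull_prob_simplex:
  "affine hull prob_simplex = {x :: real ^ 'm::finite. (\<Sum>k\<in>UNIV. x $ k) = 1}"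
proof
  show "affine hull prob_simplex \<subseteq> {x :: real ^ 'm. (\<Sum>k\<in>UNIV. x $ k) = 1}"
    by (intro hull_minimal affine_sum_eq_1) (auto simp: prob_simplex_iff)
  show "{x :: real ^ 'm. (\<Sum>k\<in>UNIV. x $ k) = 1} \<subseteq> affine hull prob_simplex"
  proof clarify
    fix x :: "real ^ 'm" assume x: "(\<Sum>k\<in>UNIV. x $ k) = 1"
    let ?S = "range (\<lambda>k. axis k 1 :: real ^ 'm)"
    have inj: "inj (\<lambda>k. axis k 1 :: real ^ 'm)" by (auto simp: inj_def axis_eq_axis)
    have "(\<Sum>v\<in>?S. x \<bullet> v) = 1"
      using x by (simp add: sum.reindex[OF inj] inner_axis)
    moreover have "(\<Sum>v\<in>?S. (x \<bullet> v) *\<^sub>R v) = x"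
      by (simp add: sum.reindex[OF inj] inner_axis basis_expansion flip: scalar_mult_eq_scaleR)
    ultimately show "x \<in> affine hull prob_simplex"
      unfolding affine_hull_explicit using axis_in_prob_simplex
      by (intro CollectI exI[of _ ?S] exI[of _ "\<lambda>v. x \<bullet> v"]) auto
  qed
qed

lemma open_pos_orthant: "open {x :: real ^ 'm::finite. \<forall>k. 0 < x $ k}"
proof -
  have "open (\<Inter>k. {x :: real ^ 'm. 0 < x $ k})"
    by (intro open_INT ballI open_Collect_less continuous_intros) auto
  then show ?thesis by (simp add: Collect_all_eq)
qed

lemma rel_interior_prob_simplex:
  "rel_interior prob_simplex = {p :: real ^ 'm::finite. (\<forall>k. 0 < p $ k) \<and> (\<Sum>k\<in>UNIV. p $ k) = 1}"
proof (intro equalityI subsetI)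
  fix p :: "real ^ 'm" assume p: "p \<in> rel_interior prob_simplex"
  then have ps: "p \<in> prob_simplex" using rel_interior_subset by blast
  obtain e where e: "0 < e" "ball p e \<inter> affine hull prob_simplex \<subseteq> prob_simplex"
    using p by (auto simp: mem_rel_interior_ball)
  have "0 < p $ l" for l
  proof (rule ccontr)
    assume "\<not> 0 < p $ l"
    with ps have l: "p $ l = 0" by (auto simp: prob_simplex_iff order_less_le)
    \<comment> \<open>Provides a second coordinate k from which l can be pushed below 0 without
      leaving the hyperplane.\<close>
    have "\<exists>k. p $ k \<noteq> 0"
      using ps by (auto simp: prob_simplex_iff intro: ccontr)
    then obtain k where "p $ k \<noteq> 0" by blast
    with l have kl: "k \<noteq> l" by auto
    \<comment> \<open>The direction has norm at most 2, so the factor \<open>e / 4\<close> moves p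
      by at most \<open>e / 2\<close>.\<close>
    define y where "y = p + (e / 4) *\<^sub>R (axis k 1 - axis l 1)"
    have "norm (axis k 1 - axis l 1 :: real ^ 'm) \<le> 2"
      using norm_triangle_ineq4[of "axis k 1 :: real ^ 'm" "axis l 1"] by simp
    then have "dist p y < e"
      using e(1) by (simp add: y_def dist_norm)
    moreover have "(\<Sum>j\<in>UNIV. (axis k 1 - axis l 1 :: real ^ 'm) $ j) = 0"
      by (simp add: sum_subtractf axis_def)
    then have "(\<Sum>j\<in>UNIV. (e / 4) * (axis k 1 - axis l 1 :: real ^ 'm) $ j) = 0"
      by (simp only: mult_zero_right flip: sum_distrib_left)
    then have "(\<Sum>j\<in>UNIV. y $ j) = 1"
      using ps by (simp only: y_def prob_simplex_iff sum.distrib vector_add_component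
          vector_scaleR_component real_scaleR_def add_0_right)
    ultimately have "y \<in> prob_simplex" using e(2) by (auto simp: affine_hull_prob_simplex)
    moreover have "y $ l < 0" using l e(1) kl by (simp add: y_def axis_def)
    ultimately show False by (auto simp: prob_simplex_iff not_le[symmetric])
  qed
  with ps show "p \<in> {p. (\<forall>k. 0 < p $ k) \<and> (\<Sum>k\<in>UNIV. p $ k) = 1}" by (simp add: prob_simplex_iff)
next
  fix p :: "real ^ 'm" assume "p \<in> {p. (\<forall>k. 0 < p $ k) \<and> (\<Sum>k\<in>UNIV. p $ k) = 1}"
  then show "p \<in> rel_interior prob_simplex"
    unfolding mem_rel_interior
    by (intro exI[of _ "{x. \<forall>k. 0 < x $ k}"])
      (auto simp: open_pos_orthant affine_hull_prob_simplex prob_simplex_iff order_less_imp_le)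
qed

lemma prob_simplex_eq_box:
  "prob_simplex = cbox 0 1 \<inter> {x :: real ^ 'm::finite. (\<Sum>k\<in>UNIV. x $ k) = 1}"
  by (auto simp: prob_simplex_def mem_box_cart)

lemma compact_prob_simplex: "compact (prob_simplex :: (real ^ 'm::finite) set)"
  unfolding prob_simplex_eq_box
  by (intro compact_Int_closed compact_cbox closed_Collect_eq continuous_intros)

lemma convex_prob_simplex: "convex (prob_simplex :: (real ^ 'm::finite) set)"
  unfolding prob_simplex_eq_box
  by (intro convex_Int convex_box affine_imp_convex affine_sum_eq_1)

context
  fixes N :: "nat ^ 'm::finite"
  assumes N: "\<And>k. 0 < N $ k"
begin

lemma win_prob_eq: "p \<in> prob_simplex \<Longrightarrow> win_prob N p = (\<chi> l. race N l p)"
  by (simp add: vec_eq_iff win_prob_eq_race N)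

lemma sum_race_eq_1:
  assumes "(\<Sum>k\<in>UNIV. x $ k) = 1"
  shows "(\<Sum>l\<in>UNIV. race N l x) = 1"
proof (rule sum_race[OF assms])
  show "j = k" if "N $ j = 0" for j k using N[of j] that by simp
qed

lemma win_prob_in_prob_simplex: "p \<in> prob_simplex \<Longrightarrow> win_prob N p \<in> prob_simplex"
  by (simp add: win_prob_eq prob_simplex_iff[of "vec_lambda _"] sum_race_eq_1)
    (simp add: prob_simplex_iff race_nonneg sum_race_eq_1)

lemma inj_on_win_prob: "inj_on (win_prob N) prob_simplex"
proof
  fix p q assume pq: "p \<in> prob_simplex" "q \<in> prob_simplex" "win_prob N p = win_prob N q"
  then have "race N l p = race N l q" for l by (simp add: win_prob_eq vec_eq_iff)
  then show "p = q" by (rule race_inj[OF pq(1,2) N])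
qed

text \<open>A player of weight 0 never wins, and with all weights positive everybody can win. Thus
  boundary and interior are not mixed.\<close>

lemma win_prob_in_rel_interior_iff:
  assumes "p \<in> prob_simplex"
  shows "win_prob N p \<in> rel_interior prob_simplex \<longleftrightarrow> p \<in> rel_interior prob_simplex"
proof
  assume R: "win_prob N p \<in> rel_interior prob_simplex"
  have "p $ k \<noteq> 0" for k
  proof
    assume "p $ k = 0"
    then have "race N k p = 0" using N by (rule race_eq_0)
    moreover have "0 < race N k p" using R by (simp add: rel_interior_prob_simplex win_prob_eq[OF assms])
    ultimately show False by simp
  qed
  with assms show "p \<in> rel_interior prob_simplex"
    by (auto simp: rel_interior_prob_simplex prob_simplex_iff order_less_le)
next
  assume "p \<in> rel_interior prob_simplex"
  then have p: "\<And>k. 0 < p $ k" by (simp add: rel_interior_prob_simplex)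
  then have "0 < race N l p" for l by (intro race_pos N) (auto intro: less_imp_le)
  then show "win_prob N p \<in> rel_interior prob_simplex"
    using win_prob_in_prob_simplex[OF assms]
    by (simp add: rel_interior_prob_simplex win_prob_eq[OF assms] prob_simplex_iff)
qed

lemma continuous_on_win_prob: "continuous_on prob_simplex (win_prob N)"
proof -
  have "continuous_on prob_simplex (\<lambda>p. \<chi> l. race N l p)"
    by (intro continuous_on_vec_lambda continuous_on_subset[OF Ck_on_imp_continuous_on[OF Ck_on_race]]) simp
  then show ?thesis by (rule continuous_on_eq) (simp add: win_prob_eq)
qed

lemma win_prob_image_rel_interior: "win_prob N ` rel_interior prob_simplex = rel_interior prob_simplex"
proof -
  let ?S = "prob_simplex :: (real ^ 'm) set"
  let ?I = "rel_interior ?S"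
  let ?H = "affine hull ?S"
  have sub: "?I \<subseteq> ?S" by (rule rel_interior_subset)
  \<comment> \<open>Written this way, the image is the trace of a compact set on the relative
    interior, hence relatively closed.\<close>
  have img: "win_prob N ` ?I = win_prob N ` ?S \<inter> ?I"
    using win_prob_in_rel_interior_iff sub by fastforce
  \<comment> \<open>Invariance of domain is applied inside the affine hull, since the simplex has
    empty interior in the ambient space.\<close>
  have "openin (top_of_set ?H) (win_prob N ` ?I)"
  proof (rule invariance_of_domain_affine_sets)
    show "win_prob N \<in> ?I \<rightarrow> ?H"
      using img sub hull_subset[of ?S affine] by blast
    show "openin (top_of_set ?H) ?I" by (rule openin_rel_interior)
    show "continuous_on ?I (win_prob N)" by (rule continuous_on_subset[OF continuous_on_win_prob sub])
    show "inj_on (win_prob N) ?I" by (rule inj_on_subset[OF inj_on_win_prob sub])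
  qed auto
  then have "openin (top_of_set ?I) (win_prob N ` ?I)"
    by (rule openin_subset_trans) (use img sub hull_subset[of ?S affine] in auto)
  moreover have "closedin (top_of_set ?I) (win_prob N ` ?I)"
    unfolding img
    by (metis Int_commute closedin_closed compact_continuous_image compact_imp_closed
        compact_prob_simplex continuous_on_win_prob)
  moreover have "connected ?I"
    by (intro convex_connected convex_rel_interior convex_prob_simplex)
  moreover have "?I \<noteq> {}"
    using axis_in_prob_simplex rel_interior_eq_empty[OF convex_prob_simplex] by blast
  ultimately show ?thesis by (metis connected_clopen image_is_empty)
qed

lemma win_prob_image_prob_simplex: "win_prob N ` prob_simplex = prob_simplex"
proof
  show "win_prob N ` prob_simplex \<subseteq> prob_simplex" using win_prob_in_prob_simplex by blast
  have "closed (win_prob N ` prob_simplex)"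
    by (intro compact_imp_closed compact_continuous_image continuous_on_win_prob compact_prob_simplex)
  moreover have "rel_interior prob_simplex \<subseteq> win_prob N ` prob_simplex"
    using win_prob_image_rel_interior rel_interior_subset by blast
  ultimately have "closure (rel_interior prob_simplex) \<subseteq> win_prob N ` prob_simplex"
    by (simp add: closure_minimal)
  then show "prob_simplex \<subseteq> win_prob N ` prob_simplex"
    by (simp add: convex_closure_rel_interior convex_prob_simplex compact_prob_simplex compact_imp_closed)
qed

text \<open>
  Extension of the winning map to the whole space. The correction term vanishes on the hyperplane of
  the simplex and makes the coordinate sum invariant, so that the Jacobian is injective also
  transversally to the simplex.
\<close>
definition race_ext :: "real ^ 'm \<Rightarrow> real ^ 'm" where
  "race_ext x = (\<chi> l. race N l x + ((\<Sum>k\<in>UNIV. x $ k) - (\<Sum>j\<in>UNIV. race N j x)) / real CARD('m))"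

text \<open>Ensures that preimages under \<open>race_ext\<close> of points of the hyperplane lie on
  the hyperplane.\<close>

lemma sum_race_ext: "(\<Sum>l\<in>UNIV. race_ext x $ l) = (\<Sum>k\<in>UNIV. x $ k)"
  by (simp add: race_ext_def sum.distrib)

lemma race_ext_eq_win_prob: "p \<in> prob_simplex \<Longrightarrow> race_ext p = win_prob N p"
  by (simp add: race_ext_def win_prob_eq sum_race_eq_1) (simp add: prob_simplex_iff sum_race_eq_1)

lemma Ck_on_race_ext: "Ck_on k UNIV race_ext"
  unfolding race_ext_def
  by (intro Ck_on_vec open_UNIV, simp only: vec_lambda_beta diff_conv_add_uminus)
    (intro Ck_on_add Ck_on_race Ck_on_divide Ck_on_sum Ck_on_const open_UNIV Ck_on_ident
      Ck_on_bounded_linear[OF _ bounded_linear_vec_nth]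
      Ck_on_bounded_linear[OF _ bounded_linear_minus[OF bounded_linear_ident]], simp)

lemma race_ext_differentiable: "race_ext differentiable (at p)"
  using Ck_on_race_ext[of "Suc 0"] by simp

lemma race_ext_derivative_nth:
  "frechet_derivative race_ext (at p) v $ l = frechet_derivative (race N l) (at p) v +
    ((\<Sum>k\<in>UNIV. v $ k) - (\<Sum>j\<in>UNIV. frechet_derivative (race N j) (at p) v)) / real CARD('m)"
proof -
  have D: "((\<lambda>x. race_ext x $ l) has_derivative (\<lambda>v. frechet_derivative race_ext (at p) v $ l)) (at p)"
    by (intro bounded_linear.has_derivative[OF bounded_linear_vec_nth]
        race_ext_differentiable[unfolded frechet_derivative_works])
  have D': "((\<lambda>x. race_ext x $ l) has_derivative (\<lambda>v. frechet_derivative (race N l) (at p) v +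
    ((\<Sum>k\<in>UNIV. v $ k) - (\<Sum>j\<in>UNIV. frechet_derivative (race N j) (at p) v)) / real CARD('m))) (at p)"
    unfolding race_ext_def vec_lambda_beta
    by (intro has_derivative_add has_derivative_diff has_derivative_sum bounded_linear.has_derivative[OF bounded_linear_divide]
        race_differentiable[unfolded frechet_derivative_works] bounded_linear_imp_has_derivative bounded_linear_vec_nth)
  show ?thesis using fun_cong[OF has_derivative_unique[OF D D'], of v] .
qed

text \<open>A kernel vector v has coordinate sum 0, as \<open>race_ext\<close> preserves sums. Then
  all players have the same derivative along v, while \<open>ex_race_derivative_pos\<close> for v
  and \<open>- v\<close> makes this common value both positive and negative.\<close>

lemma inj_race_ext_derivative:
  assumes p: "p \<in> rel_interior prob_simplex"
  shows "inj (frechet_derivative race_ext (at p))"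
proof -
  let ?D = "frechet_derivative race_ext (at p)"
  let ?d = "\<lambda>l v. frechet_derivative (race N l) (at p) v"
  have ps: "p \<in> prob_simplex" "\<And>k. 0 < p $ k"
    using p rel_interior_subset by (auto simp: rel_interior_prob_simplex prob_simplex_iff order_less_imp_le)
  have lin: "linear (?d l)" for l
    by (rule linear_frechet_derivative[OF race_differentiable])
  have "v = 0" if "?D v = 0" for v
  proof (rule ccontr)
    assume v: "v \<noteq> 0"
    have "(\<Sum>l\<in>UNIV. ?D v $ l) = (\<Sum>k\<in>UNIV. v $ k)" by (simp add: race_ext_derivative_nth sum.distrib)
    with that have v0: "(\<Sum>k\<in>UNIV. v $ k) = 0" by simp
    have c: "?d l v = (\<Sum>j\<in>UNIV. ?d j v) / real CARD('m)" for l
      using race_ext_derivative_nth[of p v l] that v0 by simp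
    obtain l where "0 < ?d l v" using ex_race_derivative_pos[OF ps N v0 v] by blast
    moreover obtain j where "0 < ?d j (- v)"
      using ex_race_derivative_pos[OF ps N, of "- v"] v0 v by (auto simp: sum_negf)
    ultimately show False using c[of l] c[of j] by (simp add: linear_neg[OF lin])
  qed
  moreover have "linear ?D"
    by (rule linear_frechet_derivative[OF race_ext_differentiable])
  ultimately show ?thesis by (simp add: linear_injective_0)
qed

lemma diffeomorphism_win_prob:
  "diffeomorphism (rel_interior prob_simplex) (rel_interior prob_simplex) (win_prob N)"
proof -
  let ?I = "rel_interior prob_simplex :: (real ^ 'm) set"
  have sub: "?I \<subseteq> prob_simplex" by (rule rel_interior_subset)
  have inj: "inj_on (win_prob N) ?I" by (rule inj_on_subset[OF inj_on_win_prob sub])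
  have "smooth_on ?I (win_prob N)"
    unfolding smooth_on_def using sub race_ext_eq_win_prob Ck_on_race_ext
    by (intro ballI exI[of _ UNIV] exI[of _ race_ext]) auto
  moreover have "smooth_on ?I (inv_into ?I (win_prob N))"
    unfolding smooth_on_def
  proof
    fix y assume "y \<in> ?I"
    then obtain x where x: "x \<in> ?I" "y = win_prob N x" using win_prob_image_rel_interior by blast
    \<comment> \<open>On the positive orthant the local inverse takes only values with positive
      coordinates.\<close>
    let ?U = "{x :: real ^ 'm. \<forall>k. 0 < x $ k}"
    have U: "Ck_on k ?U race_ext" for k
      using Ck_on_compose[of ?U "\<lambda>x. x" UNIV k race_ext] open_pos_orthant
      by (simp add: Ck_on_race_ext Ck_on_ident)
    have xU: "x \<in> ?U" using x(1) by (simp add: rel_interior_prob_simplex)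
    obtain U' V g where UV: "U' \<subseteq> ?U" "open V" "race_ext x \<in> V" "homeomorphism U' V race_ext g"
      and g: "\<And>k. Ck_on k V g"
      by (rule smooth_inverse_function[OF open_pos_orthant U xU inj_race_ext_derivative[OF x(1)]], rule that)
    \<comment> \<open>Positive coordinates and the preserved sum place \<open>g z\<close> in the
      relative interior, where \<open>race_ext\<close> is the winning map; injectivity then
      identifies the two inverses.\<close>
    have "g z = inv_into ?I (win_prob N) z" if z: "z \<in> ?I \<inter> V" for z
    proof -
      have gz: "g z \<in> U'" "race_ext (g z) = z" using UV(4) z by (auto simp: homeomorphism_def)
      then have "(\<Sum>k\<in>UNIV. g z $ k) = 1"
        using sum_race_ext[of "g z"] z by (simp add: rel_interior_prob_simplex)
      with gz UV(1) have "g z \<in> ?I" by (auto simp: rel_interior_prob_simplex)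
      moreover from this have "win_prob N (g z) = z"
        using sub gz(2) race_ext_eq_win_prob[of "g z"] by auto
      ultimately show ?thesis by (intro inv_into_f_eq[symmetric] inj)
    qed
    moreover have "y \<in> V" using UV(3) x sub race_ext_eq_win_prob by auto
    ultimately show "\<exists>U g. open U \<and> y \<in> U \<and> (\<forall>k. Ck_on k U g) \<and>
        (\<forall>z\<in>?I \<inter> U. g z = inv_into ?I (win_prob N) z)"
      using UV(2) g by blast
  qed
  ultimately show ?thesis
    using inj win_prob_image_rel_interior by (simp add: diffeomorphism_def bij_betw_def)
qed

end

theorem theorem15:
  fixes N :: "nat ^ 'm::finite"
  assumes "CARD('m) \<ge> 2"
    and "\<And>l. N $ l \<ge> 1"
  shows "bij_betw (win_prob N) prob_simplex prob_simplex \<and>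
    diffeomorphism (rel_interior prob_simplex) (rel_interior prob_simplex) (win_prob N)"
proof -
  have N: "0 < N $ l" for l using assms(2)[of l] by simp
  show ?thesis
    using inj_on_win_prob[OF N] win_prob_image_prob_simplex[OF N] diffeomorphism_win_prob[OF N]
    by (simp add: bij_betw_def)
qed

end
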